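(* In the setting described in the context (unique dominant mode $k_\star$, local near-bifurcation regime), let $\boldsymbol b\in\mathbb R^K$ be an evidence vector such that $3A^b_{k_\star}>A^b_{3k_\star}$ and such that the noncritical harmonics satisfy $|\sigma_m|\gg A_m^b$ for all $m\neq k_\star$. Then, near onset (that is, for all sufficiently small amplitudes $r>0$), the action selected by the locally stable equilibrium $\theta^\star$ of the reduced angular equation $$g_\theta(r,\theta) = \frac{A_{k_\star}^b}{\sqrt{2}}\sin(\theta_{k_\star}^b - \theta)+ \frac{\eta r^2}{\sqrt{2}}\Big[3A_{k_\star}^b\sin(\theta_{k_\star}^b - \theta)+ A_{3k_\star}^b\sin(\theta_{3k_\star}^b - 3\theta)\Big]=0$$ coincides with the projected best response, i.e. it is an element of $\arg\max_{k\in\mathcal A}[\Psi_A(\boldsymbol b)]_k$.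
   Context: The action set is $\mathcal A$, with $K$ elements indexed by the points $\theta_j=2\pi j/K$ of a discrete ring. Let $A\in\mathbb R^{K\times K}$ be real, symmetric and circulant, with eigenvectors $\boldsymbol\phi_k=(\cos(k\theta_j))_{j}$, $\boldsymbol\psi_k=(\sin(k\theta_j))_{j}$ and real eigenvalues $\lambda_k$, $k=0,\dots,\lfloor K/2\rfloor$. There is a unique index $k_\star$ with $\lambda_{k_\star}>\lambda_k$ for all $k\ne k_\star$; moreover $\lambda_{k_\star}>0$ and $0<k_\star<K/2$, so $E_c=\mathrm{span}\{\boldsymbol\phi_{k_\star},\boldsymbol\psi_{k_\star}\}$ is two-dimensional. $\Psi_A$ is the orthogonal projection of $\mathbb R^K$ onto $E_c$. The decision dynamics are $\tau_z\dot{\boldsymbol z}=-d_z\boldsymbol z+S(\alpha A\boldsymbol z+\boldsymbol b)$ with $\tau_z,d_z,\alpha>0$ and $S$ odd, $\mathcal C^3$, sigmoidal, acting componentwise, $S'(0)=1$, $s_3:=S'''(0)\neq0$. Put $\alpha_c=d_z/\lambda_{k_\star}$, $\mu=-d_z+\alpha\lambda_{k_\star}$, $\sigma_m=-d_z+\alpha_c\lambda_m$, $\eta=\frac{s_3}{4}\alpha_c^2\lambda_{k_\star}^2$. Local near-bifurcation regime: $|\mu|$, $\|\boldsymbol b\|$, $\|\boldsymbol z\|$ are sufficiently small. The reduced angular equation above is the angular part of the equilibrium equation reduced to $E_c$, where a critical component is written $\boldsymbol v=r\boldsymbol e_\theta$, $r\ge0$, $\boldsymbol e_\theta=\sqrt2(\cos\theta\,\boldsymbol\phi_{k_\star}+\sin\theta\,\boldsymbol\psi_{k_\star})$.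 Evidence harmonics: $b_j=a_0+\sum_m(a_m\cos(m\theta_j)+\beta_m\sin(m\theta_j))$, with $a_m=\frac2K\sum_jb_j\cos(m\theta_j)$, $\beta_m=\frac2K\sum_jb_j\sin(m\theta_j)$ for the modes $m$ used here; $A_m^b=\sqrt{a_m^2+\beta_m^2}$ and $\theta_m^b=\operatorname{atan2}(\beta_m,a_m)$ (terms with $A_m^b=0$ are read as $0$). In particular $\Psi_A(\boldsymbol b)=A_{k_\star}^b(\cos\theta_{k_\star}^b\,\boldsymbol\phi_{k_\star}+\sin\theta_{k_\star}^b\,\boldsymbol\psi_{k_\star})$. A zero $\theta^\star$ of $g_\theta(r,\cdot)$ is locally stable if $\partial_\theta g_\theta(r,\theta^\star)<0$. The action selected by phase $\theta^\star$ is the action $k$ maximizing the $k$-th entry of $\boldsymbol e_{\theta^\star}$, i.e. maximizing $\cos(k_\star\theta_k-\theta^\star)$. The condition $|\sigma_m|\gg A_m^b$ means that $A_m^b/|\sigma_m|$ is sufficiently small. *)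

theory Defs
  imports "HOL-Analysis.Analysis"
begin

text \<open>
  The action set is a finite type \<open>'a\<close> with \<open>K = CARD('a)\<close> elements; a bijection
  \<open>idx\<close> from \<open>'a\<close> onto \<open>{..<K}\<close> places action \<open>j\<close> at the ring position \<open>idx j\<close>.
\<close>

definition ring_pt :: "('a::finite \<Rightarrow> nat) \<Rightarrow> 'a \<Rightarrow> real" where
  "ring_pt idx j = 2 * pi * real (idx j) / real CARD('a)"

definition circulant :: "('a::finite \<Rightarrow> nat) \<Rightarrow> real^'a^'a \<Rightarrow> bool" where
  "circulant idx A \<longleftrightarrow>
     (\<exists>c :: nat \<Rightarrow> real. \<forall>i j. A $ i $ j = c ((idx j + CARD('a) - idx i) mod CARD('a)))"

definition cos_mode :: "('a::finite \<Rightarrow> nat) \<Rightarrow> nat \<Rightarrow> real^'a" where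
  "cos_mode idx k = (\<chi> j. cos (real k * ring_pt idx j))"

definition sin_mode :: "('a::finite \<Rightarrow> nat) \<Rightarrow> nat \<Rightarrow> real^'a" where
  "sin_mode idx k = (\<chi> j. sin (real k * ring_pt idx j))"

definition crit_space :: "('a::finite \<Rightarrow> nat) \<Rightarrow> nat \<Rightarrow> (real^'a) set" where
  "crit_space idx ks = span {cos_mode idx ks, sin_mode idx ks}"

definition orth_proj :: "'v::euclidean_space set \<Rightarrow> 'v \<Rightarrow> 'v" where
  "orth_proj E x = (THE p. p \<in> E \<and> (\<forall>y\<in>E. orthogonal (x - p) y))"

definition crit_dir :: "('a::finite \<Rightarrow> nat) \<Rightarrow> nat \<Rightarrow> real \<Rightarrow> real^'a" where
  "crit_dir idx ks \<theta> =
     sqrt 2 *\<^sub>R (cos \<theta> *\<^sub>R cos_mode idx ks + sin \<theta> *\<^sub>R sin_mode idx ks)"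

text \<open>
  The factor \<open>2/K\<close> is used for every \<open>m\<close>. For \<open>m = 0\<close> and \<open>m = K/2\<close> this gives twice
  the usual Fourier coefficient, and \<open>m\<close> may exceed \<open>K/2\<close> (as \<open>3 k\<^sub>\<star>\<close> can).
\<close>

definition cos_coeff :: "('a::finite \<Rightarrow> nat) \<Rightarrow> real^'a \<Rightarrow> nat \<Rightarrow> real" where
  "cos_coeff idx b m = 2 / real CARD('a) * (\<Sum>j\<in>UNIV. b $ j * cos (real m * ring_pt idx j))"

definition sin_coeff :: "('a::finite \<Rightarrow> nat) \<Rightarrow> real^'a \<Rightarrow> nat \<Rightarrow> real" where
  "sin_coeff idx b m = 2 / real CARD('a) * (\<Sum>j\<in>UNIV. b $ j * sin (real m * ring_pt idx j))"

definition amp :: "('a::finite \<Rightarrow> nat) \<Rightarrow> real^'a \<Rightarrow> nat \<Rightarrow> real" where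
  "amp idx b m = sqrt ((cos_coeff idx b m)\<^sup>2 + (sin_coeff idx b m)\<^sup>2)"

text \<open>\<open>Arg (Complex x y)\<close> is \<open>atan2(y, x)\<close>, with value \<open>0\<close> at the origin.\<close>

definition phase :: "('a::finite \<Rightarrow> nat) \<Rightarrow> real^'a \<Rightarrow> nat \<Rightarrow> real" where
  "phase idx b m = Arg (Complex (cos_coeff idx b m) (sin_coeff idx b m))"

definition C3_fun :: "(real \<Rightarrow> real) \<Rightarrow> bool" where
  "C3_fun S \<longleftrightarrow> (\<forall>n<3. \<forall>x. (deriv ^^ n) S differentiable (at x)) \<and>
                 continuous_on UNIV ((deriv ^^ 3) S)"

text \<open>Monotone and bounded, hence saturating at both ends.\<close>

definition sigmoidal :: "(real \<Rightarrow> real) \<Rightarrow> bool" where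
  "sigmoidal S \<longleftrightarrow> mono S \<and> bounded (range S)"

definition alpha_crit :: "real \<Rightarrow> (nat \<Rightarrow> real) \<Rightarrow> nat \<Rightarrow> real" where
  "alpha_crit d lam ks = d / lam ks"

definition mu :: "real \<Rightarrow> (nat \<Rightarrow> real) \<Rightarrow> nat \<Rightarrow> real \<Rightarrow> real" where
  "mu d lam ks alpha = - d + alpha * lam ks"

definition sigma_mode :: "real \<Rightarrow> (nat \<Rightarrow> real) \<Rightarrow> nat \<Rightarrow> nat \<Rightarrow> real" where
  "sigma_mode d lam ks m = - d + alpha_crit d lam ks * lam m"

definition eta :: "(real \<Rightarrow> real) \<Rightarrow> real \<Rightarrow> (nat \<Rightarrow> real) \<Rightarrow> nat \<Rightarrow> real" where
  "eta S d lam ks = (deriv ^^ 3) S 0 / 4 * (alpha_crit d lam ks)\<^sup>2 * (lam ks)\<^sup>2"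

definition g_theta ::
  "('a::finite \<Rightarrow> nat) \<Rightarrow> nat \<Rightarrow> real \<Rightarrow> real^'a \<Rightarrow> real \<Rightarrow> real \<Rightarrow> real" where
  "g_theta idx ks h b r \<theta> =
     amp idx b ks / sqrt 2 * sin (phase idx b ks - \<theta>) +
     h * r\<^sup>2 / sqrt 2 *
       (3 * amp idx b ks * sin (phase idx b ks - \<theta>) +
        amp idx b (3 * ks) * sin (phase idx b (3 * ks) - 3 * \<theta>))"

definition stable_zero :: "(real \<Rightarrow> real) \<Rightarrow> real \<Rightarrow> bool" where
  "stable_zero g \<theta> \<longleftrightarrow> g \<theta> = 0 \<and> (\<exists>D<0. (g has_real_derivative D) (at \<theta>))"

definition max_actions :: "real^'a \<Rightarrow> 'a::finite set" where
  "max_actions v = {k. is_arg_max (\<lambda>j. v $ j) (\<lambda>_. True) k}"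

end

theory Submission
  imports Defs
begin

text \<open>
  Up to a positive factor the angular equation is a perturbation of \<open>sin (p - \<theta>) = 0\<close> of size
  \<open>O(r\<^sup>2)\<close>. Its zeros satisfy \<open>sin (p - \<theta>) = O(r\<^sup>2)\<close>, the stable one has \<open>cos (p - \<theta>) > 0\<close>, and so
  the selected direction differs from the one of the projected evidence by \<open>O(r\<^sup>2)\<close>. Since there
  are finitely many actions, suboptimal ones lose by a fixed margin, so a small change of
  direction can at most break ties.
\<close>

section \<open>Zeros and stability of the normalised angular equation\<close>

text \<open>This is \<open>g_theta\<close> divided by \<open>amp idx b ks / sqrt 2\<close>, with
  \<open>e\<close> standing for \<open>h * r\<^sup>2\<close> and \<beta> for the ratio of the
  amplitudes at \<open>3 * ks\<close> and \<open>ks\<close>. The amplitude hypothesis enters below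
  as the bound 3 on \<beta>.\<close>

definition perturbed_sine :: "real \<Rightarrow> real \<Rightarrow> real \<Rightarrow> real \<Rightarrow> real \<Rightarrow> real" where
  "perturbed_sine e \<beta> p q \<theta> = (1 + 3 * e) * sin (p - \<theta>) + e * \<beta> * sin (q - 3 * \<theta>)"

lemma abs_mult_mult_le:
  fixes e \<beta> s :: real
  assumes "\<bar>\<beta>\<bar> \<le> 3" "\<bar>s\<bar> \<le> c"
  shows "\<bar>e * \<beta> * s\<bar> \<le> 3 * c * \<bar>e\<bar>"
proof -
  have "\<bar>\<beta>\<bar> * \<bar>s\<bar> \<le> 3 * c"
    using assms by (intro mult_mono) auto
  then have "\<bar>e\<bar> * (\<bar>\<beta>\<bar> * \<bar>s\<bar>) \<le> \<bar>e\<bar> * (3 * c)"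
    by (intro mult_left_mono) auto
  then show ?thesis
    by (simp add: abs_mult mult_ac)
qed

lemma one_plus_mult_ge:
  fixes e x :: real
  assumes "\<bar>e\<bar> \<le> 1/100"
  shows "97/100 * \<bar>x\<bar> \<le> \<bar>(1 + 3 * e) * x\<bar>"
proof -
  have "97/100 \<le> \<bar>1 + 3 * e\<bar>"
    using assms by linarith
  then show ?thesis
    unfolding abs_mult by (rule mult_right_mono) simp
qed

text \<open>At a zero the two terms balance, which gives 97/100 times the sine at most
  \<open>3 * \<bar>e\<bar>\<close>; the factor 4 rounds up 300/97.\<close>

lemma perturbed_sine_zero_sin:
  assumes "\<bar>e\<bar> \<le> 1/100" "\<bar>\<beta>\<bar> \<le> 3" "perturbed_sine e \<beta> p q \<theta> = 0"
  shows "\<bar>sin (p - \<theta>)\<bar> \<le> 4 * \<bar>e\<bar>"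
proof -
  have "\<bar>(1 + 3 * e) * sin (p - \<theta>)\<bar> = \<bar>e * \<beta> * sin (q - 3 * \<theta>)\<bar>"
    using assms(3) by (simp add: perturbed_sine_def)
  with one_plus_mult_ge[OF assms(1), of "sin (p - \<theta>)"]
    abs_mult_mult_le[OF assms(2), of "sin (q - 3 * \<theta>)" 1 e]
  show ?thesis by simp
qed

text \<open>The bound 1/25 is \<open>4 * \<bar>e\<bar>\<close> at the threshold 1/100 for
  \<open>\<bar>e\<bar>\<close>.\<close>

lemma small_sin_abs_cos:
  fixes u :: real
  assumes "\<bar>sin u\<bar> \<le> 1/25"
  shows "99/100 < \<bar>cos u\<bar>"
proof -
  have "(sin u)\<^sup>2 \<le> (1/25)\<^sup>2"
    using power_mono[OF assms, of 2] by simp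
  then have "(99/100)\<^sup>2 < \<bar>cos u\<bar>\<^sup>2"
    using sin_cos_squared_add[of u] by (simp add: power2_eq_square)
  then show ?thesis
    by (rule power_less_imp_less_base) simp
qed

text \<open>At a zero the cosine exceeds 99/100 in absolute value, so the leading part of the
  derivative exceeds 96/100, while the third harmonic contributes at most 9/100. The sign of the
  cosine therefore decides stability.\<close>

lemma stable_zero_perturbed_sine:
  assumes e: "\<bar>e\<bar> \<le> 1/100" and b: "\<bar>\<beta>\<bar> \<le> 3"
  shows "stable_zero (perturbed_sine e \<beta> p q) \<theta> \<longleftrightarrow>
    perturbed_sine e \<beta> p q \<theta> = 0 \<and> 0 < cos (p - \<theta>)"
proof -
  let ?D = "- ((1 + 3 * e) * cos (p - \<theta>) + 3 * (e * \<beta> * cos (q - 3 * \<theta>)))"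
  have der: "(perturbed_sine e \<beta> p q has_real_derivative ?D) (at \<theta>)"
    unfolding perturbed_sine_def by (auto intro!: derivative_eq_intros simp: algebra_simps)
  then have st: "stable_zero (perturbed_sine e \<beta> p q) \<theta> \<longleftrightarrow>
      perturbed_sine e \<beta> p q \<theta> = 0 \<and> ?D < 0"
    unfolding stable_zero_def using DERIV_unique by blast
  have "?D < 0 \<longleftrightarrow> 0 < cos (p - \<theta>)" if z: "perturbed_sine e \<beta> p q \<theta> = 0"
  proof -
    have c: "99/100 < \<bar>cos (p - \<theta>)\<bar>"
      using perturbed_sine_zero_sin[OF e b z] e by (intro small_sin_abs_cos) linarith
    have r: "\<bar>e * \<beta> * cos (q - 3 * \<theta>)\<bar> \<le> 3 * \<bar>e\<bar>"
      using abs_mult_mult_le[OF b, of "cos (q - 3 * \<theta>)" 1 e] by simp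
    have m: "97/100 * \<bar>cos (p - \<theta>)\<bar> \<le> \<bar>(1 + 3 * e) * cos (p - \<theta>)\<bar>"
      by (rule one_plus_mult_ge[OF e])
    have pos: "0 < 1 + 3 * e"
      using e by linarith
    show ?thesis
    proof (cases "0 < cos (p - \<theta>)")
      case True
      then have "0 < (1 + 3 * e) * cos (p - \<theta>)"
        using pos by simp
      then show ?thesis
        using True c r m e by linarith
    next
      case False
      then have "(1 + 3 * e) * cos (p - \<theta>) \<le> 0"
        using pos by (simp add: mult_le_0_iff)
      then show ?thesis
        using False c r m e by linarith
    qed
  qed
  with st show ?thesis by blast
qed

text \<open>Lets the third harmonic be compared with \<open>sin h\<close>, which can then be
  cancelled in the uniqueness proof.\<close>

lemma abs_sin_triple_le:
  fixes y :: real
  shows "\<bar>sin (3 * y)\<bar> \<le> 3 * \<bar>sin y\<bar>"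
proof -
  have "sin (3 * y) = sin (2 * y) * cos y + cos (2 * y) * sin y"
    using sin_add[of "2 * y" y] by simp
  also have "sin (2 * y) = 2 * sin y * cos y"
    by (rule sin_double)
  finally have "sin (3 * y) = sin y * (2 * (cos y)\<^sup>2 + cos (2 * y))"
    by (simp add: power2_eq_square algebra_simps)
  moreover have "\<bar>2 * (cos y)\<^sup>2 + cos (2 * y)\<bar> \<le> 3"
    using abs_cos_le_one[of "2 * y"] abs_square_le_1[of "cos y"] zero_le_power2[of "cos y"]
      abs_cos_le_one[of y]
    by linarith
  ultimately show ?thesis
    by (simp add: abs_mult mult.commute[of "\<bar>sin y\<bar>"] mult_right_mono)
qed

text \<open>Subtracting the equations at the two zeros and turning differences into products leaves
  a factor \<open>sin h\<close> or \<open>sin (3 * h)\<close> in each term. Cancelling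
  \<open>sin h\<close> forces \<open>cos (p - m)\<close> to be small, whereas stability at both
  points makes it nearly 1 in absolute value.\<close>

lemma perturbed_sine_stable_zero_unique:
  assumes e: "\<bar>e\<bar> \<le> 1/100" and b: "\<bar>\<beta>\<bar> \<le> 3"
    and z: "stable_zero (perturbed_sine e \<beta> p q) x" "stable_zero (perturbed_sine e \<beta> p q) y"
    and xy: "\<bar>x - y\<bar> < 2 * pi"
  shows "x = y"
proof (rule ccontr)
  assume "x \<noteq> y"
  define h m where "h = (x - y) / 2" and "m = (x + y) / 2"
  have x: "x = m + h" and y: "y = m - h"
    by (simp_all add: h_def m_def field_simps)
  \<comment> \<open>A distance below one full period gives \<open>\<bar>h\<bar> < pi\<close>, where
    the sine vanishes only at 0.\<close>
  have s: "sin h \<noteq> 0"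
  proof -
    have "h \<noteq> 0" "h < pi" "- pi < h"
      using xy \<open>x \<noteq> y\<close> by (simp_all add: h_def abs_less_iff)
    then show ?thesis
      using sin_gt_zero[of h] sin_gt_zero[of "- h"] by (cases "0 < h") auto
  qed
  have zx: "perturbed_sine e \<beta> p q x = 0" "0 < cos (p - x)"
    and zy: "perturbed_sine e \<beta> p q y = 0" "0 < cos (p - y)"
    using z stable_zero_perturbed_sine[OF e b] by auto
  have "99/100 < \<bar>cos (p - x)\<bar>" "99/100 < \<bar>cos (p - y)\<bar>"
    using perturbed_sine_zero_sin[OF e b zx(1)] perturbed_sine_zero_sin[OF e b zy(1)] e
    by (intro small_sin_abs_cos; linarith)+
  \<comment> \<open>Stability makes both cosines positive, so the bounds on their absolute values
    survive averaging.\<close>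
  then have "99/100 < (cos (p - x) + cos (p - y)) / 2"
    using zx zy by simp
  also have "\<dots> = cos (p - m) * cos h"
    using cos_add[of "p - m" h] cos_diff[of "p - m" h] by (simp add: x y algebra_simps)
  also have "\<dots> \<le> \<bar>cos (p - m)\<bar> * \<bar>cos h\<bar>"
    by (metis abs_ge_self abs_mult)
  also have "\<dots> \<le> \<bar>cos (p - m)\<bar>"
    by (simp add: mult_left_le)
  finally have big: "99/100 < \<bar>cos (p - m)\<bar>" .
  have d1: "sin (p - x) - sin (p - y) = - 2 * (sin h * cos (p - m))"
    using sin_add[of "p - m" h] sin_diff[of "p - m" h] by (simp add: x y algebra_simps)
  have d2: "sin (q - 3 * x) - sin (q - 3 * y) = - 2 * (sin (3 * h) * cos (q - 3 * m))"
    using sin_add[of "q - 3 * m" "3 * h"] sin_diff[of "q - 3 * m" "3 * h"]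
    by (simp add: x y algebra_simps)
  define P Q where "P = (1 + 3 * e) * (sin h * cos (p - m))"
    and "Q = e * \<beta> * (sin (3 * h) * cos (q - 3 * m))"
  have "perturbed_sine e \<beta> p q x - perturbed_sine e \<beta> p q y =
      (1 + 3 * e) * (sin (p - x) - sin (p - y)) + e * \<beta> * (sin (q - 3 * x) - sin (q - 3 * y))"
    unfolding perturbed_sine_def by algebra
  also have "\<dots> = - 2 * P - 2 * Q"
    unfolding d1 d2 P_def Q_def by algebra
  finally have "\<bar>P\<bar> = \<bar>Q\<bar>"
    using zx(1) zy(1) by linarith
  moreover have "\<bar>sin (3 * h) * cos (q - 3 * m)\<bar> \<le> 3 * \<bar>sin h\<bar>"
    using abs_sin_triple_le[of h] mult_left_le[of "\<bar>cos (q - 3 * m)\<bar>" "\<bar>sin (3 * h)\<bar>"]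
    by (simp add: abs_mult)
  ultimately have "97/100 * \<bar>sin h * cos (p - m)\<bar> \<le> 3 * (3 * \<bar>sin h\<bar>) * \<bar>e\<bar>"
    using one_plus_mult_ge[OF e, of "sin h * cos (p - m)"]
      abs_mult_mult_le[OF b, of "sin (3 * h) * cos (q - 3 * m)" "3 * \<bar>sin h\<bar>" e]
    unfolding P_def Q_def by linarith
  then have "\<bar>sin h\<bar> * (97/100 * \<bar>cos (p - m)\<bar>) \<le> \<bar>sin h\<bar> * (9 * \<bar>e\<bar>)"
    by (simp add: abs_mult mult_ac)
  then have "97/100 * \<bar>cos (p - m)\<bar> \<le> 9 * \<bar>e\<bar>"
    using s by simp
  then show False
    using big e by linarith
qed

lemma perturbed_sine_stable_zero_exists:
  assumes e: "\<bar>e\<bar> \<le> 1/100" and b: "\<bar>\<beta>\<bar> \<le> 3"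
  shows "\<exists>\<theta>. 0 \<le> \<theta> \<and> \<theta> < 2 * pi \<and> stable_zero (perturbed_sine e \<beta> p q) \<theta>"
proof -
  let ?F = "perturbed_sine e \<beta> p q"
  have r: "\<bar>e * \<beta> * sin (q - 3 * \<theta>)\<bar> \<le> 3 * \<bar>e\<bar>" for \<theta>
    using abs_mult_mult_le[OF b, of "sin (q - 3 * \<theta>)" 1 e] by simp
  \<comment> \<open>The leading term is \<open>1 + 3 * e\<close> at this end and its negative at the
    other; each outweighs a perturbation of at most \<open>3 * \<bar>e\<bar>\<close>.\<close>
  have "0 \<le> ?F (p - pi / 2)"
    using r[of "p - pi / 2"] e unfolding perturbed_sine_def by simp
  moreover have "?F (p + pi / 2) \<le> 0"
    using r[of "p + pi / 2"] e unfolding perturbed_sine_def by simp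
  moreover have "continuous_on {p - pi / 2..p + pi / 2} ?F"
    unfolding perturbed_sine_def by (intro continuous_intros)
  ultimately obtain x where x: "p - pi / 2 \<le> x" "x \<le> p + pi / 2" "?F x = 0"
    using IVT2'[of ?F "p + pi / 2" 0 "p - pi / 2"] by auto
  \<comment> \<open>Whole periods are removed to bring the zero into one turn; the third harmonic
    then shifts by \<open>3 * n\<close> periods.\<close>
  define n where "n = \<lfloor>x / (2 * pi)\<rfloor>"
  define \<theta> where "\<theta> = x - 2 * pi * of_int n"
  have trig: "sin (2 * pi * of_int k) = 0" "cos (2 * pi * of_int k) = 1" for k :: int
    by (auto intro: sin_integer_2pi cos_integer_2pi)
  have p1: "p - \<theta> = (p - x) + 2 * pi * of_int n"
    and p2: "q - 3 * \<theta> = (q - 3 * x) + 2 * pi * of_int (3 * n)"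
    by (simp_all add: \<theta>_def algebra_simps)
  have "?F \<theta> = ?F x"
    unfolding perturbed_sine_def p1 p2 sin_add[of _ "2 * pi * of_int _"] trig by simp
  moreover have "cos (p - \<theta>) = cos (p - x)"
    unfolding p1 cos_add[of _ "2 * pi * of_int _"] trig by simp
  \<comment> \<open>The interval gives only a nonnegative cosine; strictness comes from the small
    sine at a zero.\<close>
  moreover have "0 < cos (p - x)"
  proof -
    have "0 \<le> cos (p - x)"
      using x by (intro cos_ge_zero) auto
    moreover have "99/100 < \<bar>cos (p - x)\<bar>"
      using perturbed_sine_zero_sin[OF e b x(3)] e by (intro small_sin_abs_cos) linarith
    ultimately show ?thesis by linarith
  qed
  ultimately have "stable_zero ?F \<theta>"
    using x stable_zero_perturbed_sine[OF e b] by simp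
  moreover have "0 \<le> \<theta>" "\<theta> < 2 * pi"
  proof -
    have "of_int n * (2 * pi) \<le> x" "x < (of_int n + 1) * (2 * pi)"
      using of_int_floor_le[of "x / (2 * pi)"] real_of_int_floor_add_one_gt[of "x / (2 * pi)"]
      unfolding n_def
      by (simp_all only: pos_le_divide_eq pos_divide_less_eq pi_gt_zero mult_pos_pos zero_less_numeral)
    then show "0 \<le> \<theta>" "\<theta> < 2 * pi"
      by (simp_all add: \<theta>_def algebra_simps)
  qed
  ultimately show ?thesis by blast
qed

lemma stable_zero_cmult:
  assumes "0 < c"
  shows "stable_zero (\<lambda>\<theta>. c * f \<theta>) \<theta> \<longleftrightarrow> stable_zero f \<theta>"
proof -
  have scale: "stable_zero (\<lambda>\<theta>. c * f \<theta>) \<theta>" if c: "0 < c" and f: "stable_zero f \<theta>" for c f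
  proof -
    obtain D where "D < 0" "(f has_real_derivative D) (at \<theta>)" "f \<theta> = 0"
      using f unfolding stable_zero_def by blast
    then show ?thesis
      using DERIV_cmult[of f D \<theta> UNIV c] mult_pos_neg[OF c, of D]
      by (auto simp: stable_zero_def)
  qed
  have "(\<lambda>\<theta>. inverse c * (c * f \<theta>)) = f"
    using assms by auto
  then show ?thesis
    using scale[of c f] scale[of "inverse c" "\<lambda>\<theta>. c * f \<theta>"] assms by auto
qed

section \<open>From nearby phases to selected actions\<close>

text \<open>Angles matter only modulo full turns, so closeness is measured by the sine together with
  the sign of the cosine. The error \<open>1 - cos u\<close> is at most the squared sine, as the
  cosine lies between 0 and 1.\<close>

lemma abs_cos_shift_diff_le:
  fixes x p \<theta> :: real
  assumes "0 \<le> cos (p - \<theta>)"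
  shows "\<bar>cos (x - \<theta>) - cos (x - p)\<bar> \<le> 2 * \<bar>sin (p - \<theta>)\<bar>"
proof -
  let ?u = "p - \<theta>"
  have "cos (x - \<theta>) = cos (x - p) * cos ?u - sin (x - p) * sin ?u"
    using cos_add[of "x - p" ?u] by simp
  then have "cos (x - \<theta>) - cos (x - p) = - (cos (x - p) * (1 - cos ?u)) - sin (x - p) * sin ?u"
    by (simp add: algebra_simps)
  moreover have "\<bar>cos (x - p) * (1 - cos ?u)\<bar> \<le> 1 - cos ?u"
    using mult_right_mono[of "\<bar>cos (x - p)\<bar>" 1 "1 - cos ?u"] by (simp add: abs_mult)
  moreover have "\<bar>sin (x - p) * sin ?u\<bar> \<le> \<bar>sin ?u\<bar>"
    using mult_right_mono[of "\<bar>sin (x - p)\<bar>" 1 "\<bar>sin ?u\<bar>"] by (simp add: abs_mult)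
  moreover have "1 - cos ?u \<le> \<bar>sin ?u\<bar>"
  proof -
    have "(cos ?u)\<^sup>2 \<le> cos ?u"
      using assms by (simp add: power2_eq_square mult_left_le)
    moreover have "(sin ?u)\<^sup>2 \<le> \<bar>sin ?u\<bar>"
      using mult_left_le[of "\<bar>sin ?u\<bar>" "\<bar>sin ?u\<bar>"]
      by (simp add: power2_eq_square)
    ultimately show ?thesis
      using sin_cos_squared_add[of ?u] by linarith
  qed
  ultimately show ?thesis by linarith
qed

text \<open>A suboptimal entry of \<open>v\<close> would have to make up a gap of at least \<gamma>,
  but two entries together move by less than that. Only an inclusion results, since \<open>w\<close>
  may break ties of \<open>v\<close>.\<close>

lemma max_actions_stable:
  fixes v :: "real^'a::finite"
  obtains \<delta> where "0 < \<delta>"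
    "\<And>w :: real^'a. (\<And>j. \<bar>w $ j - v $ j\<bar> < \<delta>) \<Longrightarrow> max_actions w \<subseteq> max_actions v"
proof -
  let ?P = "{v $ j - v $ i | i j. v $ i < v $ j}"
  \<comment> \<open>The inserted 1 keeps the minimum defined and positive when \<open>v\<close> is
    constant and \<open>?P\<close> is empty.\<close>
  define \<gamma> where "\<gamma> = Min (insert 1 ?P)"
  have "finite ?P"
    by (rule finite_subset[of _ "(\<lambda>(i, j). v $ j - v $ i) ` UNIV"]) auto
  then have pos: "0 < \<gamma>" and gap: "\<And>i j. v $ i < v $ j \<Longrightarrow> \<gamma> \<le> v $ j - v $ i"
    unfolding \<gamma>_def by (auto intro!: Min_le)
  have "max_actions w \<subseteq> max_actions v" if w: "\<And>j. \<bar>w $ j - v $ j\<bar> < \<gamma> / 2" for w :: "real^'a"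
  proof
    fix k
    assume "k \<in> max_actions w"
    then have k: "w $ j \<le> w $ k" for j
      by (auto simp: max_actions_def is_arg_max_linorder)
    have "v $ j \<le> v $ k" for j
      using gap[of k j] k[of j] w[of j] w[of k] by linarith
    then show "k \<in> max_actions v"
      by (auto simp: max_actions_def is_arg_max_linorder)
  qed
  then show ?thesis
    using that[of "\<gamma> / 2"] pos by simp
qed

lemma max_actions_scaleR:
  assumes "0 < c"
  shows "max_actions (c *\<^sub>R v) = max_actions v"
  using assms by (auto simp: max_actions_def is_arg_max_linorder)

section \<open>Fourier modes on the ring and the projection onto the critical space\<close>

text \<open>The sum is a full geometric series in a K-th root of unity, which differs from 1 because
  K does not divide \<open>m\<close>.\<close>

lemma sum_cis_ring_pt:
  fixes idx :: "'a::finite \<Rightarrow> nat"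
  assumes idx: "bij_betw idx UNIV {..<CARD('a)}" and m: "0 < m" "m < CARD('a)"
  shows "(\<Sum>j\<in>UNIV. cis (real m * ring_pt idx j)) = 0"
proof -
  let ?K = "CARD('a)"
  let ?x = "2 * pi * real m / real ?K"
  have K: "?K > 0" by simp
  have "cis ?x \<noteq> 1"
  proof
    assume "cis ?x = 1"
    then have "cos ?x = 1"
      by (simp add: complex_eq_iff)
    then obtain n :: int where "?x = of_int n * 2 * pi"
      using cos_one_2pi_int by blast
    then have "real m = of_int n * real ?K"
      using K by (simp add: field_simps)
    then have n: "int m = n * int ?K"
      by (metis of_int_eq_iff of_int_mult of_int_of_nat_eq)
    then have "int ?K dvd int m" by simp
    then show False
      using m by (auto dest: dvd_imp_le)
  qed
  have "(\<Sum>j\<in>UNIV. cis (real m * ring_pt idx j)) = (\<Sum>j\<in>UNIV. cis ?x ^ idx j)"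
    unfolding Complex.DeMoivre by (simp add: ring_pt_def mult_ac)
  also have "\<dots> = (\<Sum>n<?K. cis ?x ^ n)"
    using idx by (rule sum.reindex_bij_betw)
  also have "\<dots> = (cis ?x ^ ?K - 1) / (cis ?x - 1)"
    using \<open>cis ?x \<noteq> 1\<close> by (rule geometric_sum)
  also have "cis ?x ^ ?K = cis (2 * pi * real m)"
    using K unfolding Complex.DeMoivre by simp
  also have "cis (2 * pi * real m) = 1"
    by (rule cis_multiple_2pi) simp
  finally show ?thesis by simp
qed

text \<open>Double-angle formulas reduce everything to the sum for mode \<open>2 * k\<close>, which
  vanishes by strictness of \<open>2 * k < CARD('a)\<close>; at equality the sine mode would be
  zero.\<close>

lemma mode_inner:
  fixes idx :: "'a::finite \<Rightarrow> nat"
  assumes idx: "bij_betw idx UNIV {..<CARD('a)}" and k: "0 < k" "2 * k < CARD('a)"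
  shows "cos_mode idx k \<bullet> cos_mode idx k = real CARD('a) / 2"
    and "sin_mode idx k \<bullet> sin_mode idx k = real CARD('a) / 2"
    and "cos_mode idx k \<bullet> sin_mode idx k = 0"
proof -
  let ?t = "\<lambda>j. real k * ring_pt idx j"
  have *: "(\<Sum>j\<in>UNIV. cis (2 * ?t j)) = 0"
    using sum_cis_ring_pt[OF idx, of "2 * k"] k by (simp add: mult_ac)
  have c: "(\<Sum>j\<in>UNIV. cos (2 * ?t j)) = 0" and s: "(\<Sum>j\<in>UNIV. sin (2 * ?t j)) = 0"
    using arg_cong[OF *, of Re] arg_cong[OF *, of Im] by simp_all
  have "cos_mode idx k \<bullet> cos_mode idx k = (\<Sum>j\<in>UNIV. (1 + cos (2 * ?t j)) / 2)"
    unfolding inner_vec_def cos_mode_def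
    by (intro sum.cong refl) (simp add: cos_double_cos power2_eq_square)
  also have "\<dots> = real CARD('a) / 2"
    using c by (simp add: sum_divide_distrib[symmetric] sum.distrib)
  finally show "cos_mode idx k \<bullet> cos_mode idx k = real CARD('a) / 2" .
  have "sin_mode idx k \<bullet> sin_mode idx k = (\<Sum>j\<in>UNIV. (1 - cos (2 * ?t j)) / 2)"
    unfolding inner_vec_def sin_mode_def
    by (intro sum.cong refl) (simp add: cos_double_sin power2_eq_square)
  also have "\<dots> = real CARD('a) / 2"
    using c by (simp add: sum_divide_distrib[symmetric] sum_subtractf)
  finally show "sin_mode idx k \<bullet> sin_mode idx k = real CARD('a) / 2" .
  have "cos_mode idx k \<bullet> sin_mode idx k = (\<Sum>j\<in>UNIV. sin (2 * ?t j) / 2)"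
    unfolding inner_vec_def cos_mode_def sin_mode_def
    by (intro sum.cong refl) (simp add: sin_double)
  also have "\<dots> = 0"
    using s by (simp add: sum_divide_distrib[symmetric])
  finally show "cos_mode idx k \<bullet> sin_mode idx k = 0" .
qed

text \<open>Resolves the description in \<open>orth_proj\<close>: the difference of two candidates
  lies in \<open>E\<close> and is orthogonal to both residuals, hence to itself.\<close>

lemma orth_proj_eqI:
  assumes E: "subspace E" and p: "p \<in> E" "\<And>y. y \<in> E \<Longrightarrow> orthogonal (x - p) y"
  shows "orth_proj E x = p"
  unfolding orth_proj_def
proof (rule the_equality)
  fix p'
  assume p': "p' \<in> E \<and> (\<forall>y\<in>E. orthogonal (x - p') y)"
  then have "p - p' \<in> E"
    using E p by (simp add: subspace_diff)
  then have "(x - p) \<bullet> (p - p') = 0" "(x - p') \<bullet> (p - p') = 0"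
    using p p' by (auto simp: orthogonal_def)
  then have "(p - p') \<bullet> (p - p') = 0"
    by (simp add: inner_diff_left)
  then show "p' = p" by simp
qed (use p in auto)

lemma orth_proj_crit_space:
  fixes idx :: "'a::finite \<Rightarrow> nat" and b :: "real^'a"
  assumes idx: "bij_betw idx UNIV {..<CARD('a)}" and k: "0 < k" "2 * k < CARD('a)"
  shows "orth_proj (crit_space idx k) b =
    cos_coeff idx b k *\<^sub>R cos_mode idx k + sin_coeff idx b k *\<^sub>R sin_mode idx k"
proof (rule orth_proj_eqI)
  let ?p = "cos_coeff idx b k *\<^sub>R cos_mode idx k + sin_coeff idx b k *\<^sub>R sin_mode idx k"
  note inner = mode_inner[OF idx k]
  show "subspace (crit_space idx k)"
    by (simp add: crit_space_def)
  show "?p \<in> crit_space idx k"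
    unfolding crit_space_def by (intro span_add span_scale span_base) auto
  \<comment> \<open>The factor 2/K in the coefficients is the inverse of the squared norm K/2 of
    each mode.\<close>
  have "b \<bullet> cos_mode idx k = real CARD('a) / 2 * cos_coeff idx b k"
    "b \<bullet> sin_mode idx k = real CARD('a) / 2 * sin_coeff idx b k"
    by (simp_all add: cos_coeff_def sin_coeff_def inner_vec_def cos_mode_def sin_mode_def)
  then have "orthogonal (b - ?p) (cos_mode idx k)" "orthogonal (b - ?p) (sin_mode idx k)"
    by (simp_all add: inner orthogonal_def inner_diff_left inner_add_left
        inner_commute[of "sin_mode idx k" "cos_mode idx k"])
  then have "\<And>v. v \<in> {cos_mode idx k, sin_mode idx k} \<Longrightarrow> orthogonal (b - ?p) v"
    by blast
  then show "orthogonal (b - ?p) y" if "y \<in> crit_space idx k" for y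
    using orthogonal_to_span[OF that[unfolded crit_space_def]] by blast
qed

lemma crit_dir_nth: "crit_dir idx k \<theta> $ j = sqrt 2 * cos (real k * ring_pt idx j - \<theta>)"
  by (simp add: crit_dir_def cos_mode_def sin_mode_def cos_diff mult_ac)

text \<open>Polar form of the complex coefficient; it also covers the zero coefficient, whose
  amplitude is 0.\<close>

lemma amp_phase:
  "cos_coeff idx b m = amp idx b m * cos (phase idx b m)"
  "sin_coeff idx b m = amp idx b m * sin (phase idx b m)"
proof -
  have "rcis (amp idx b m) (phase idx b m) = Complex (cos_coeff idx b m) (sin_coeff idx b m)"
    using rcis_cmod_Arg[of "Complex (cos_coeff idx b m) (sin_coeff idx b m)"]
    by (simp add: amp_def phase_def complex_norm)
  then show "cos_coeff idx b m = amp idx b m * cos (phase idx b m)"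
    "sin_coeff idx b m = amp idx b m * sin (phase idx b m)"
    by (simp_all add: complex_eq_iff)
qed

text \<open>For positive amplitude, the best response is thus what the phase of \<open>b\<close>
  itself selects.\<close>

lemma orth_proj_crit_dir:
  fixes idx :: "'a::finite \<Rightarrow> nat" and b :: "real^'a"
  assumes "bij_betw idx UNIV {..<CARD('a)}" "0 < k" "2 * k < CARD('a)"
  shows "orth_proj (crit_space idx k) b =
    (amp idx b k / sqrt 2) *\<^sub>R crit_dir idx k (phase idx b k)"
  by (simp add: orth_proj_crit_space[OF assms] amp_phase crit_dir_def scaleR_add_right)

section \<open>Transfer to the angular equation and choice of the amplitude range\<close>

lemma g_theta_perturbed_sine:
  assumes "amp idx b k \<noteq> 0"
  shows "g_theta idx k h b r = (\<lambda>\<theta>. amp idx b k / sqrt 2 *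
    perturbed_sine (h * r\<^sup>2) (amp idx b (3 * k) / amp idx b k) (phase idx b k) (phase idx b (3 * k)) \<theta>)"
  using assms by (intro ext) (simp add: g_theta_def perturbed_sine_def field_simps)

text \<open>
  Smallness of \<open>r\<close> may depend on \<open>b\<close> here: it is measured against the margin by which suboptimal
  actions lose, and this margin tends to zero as \<open>b\<close> approaches a tie.
\<close>

lemma angular_equilibrium_selects_best_response:
  fixes idx :: "'a::finite \<Rightarrow> nat" and b :: "real^'a"
  assumes idx: "bij_betw idx UNIV {..<CARD('a)}" and k: "0 < k" "2 * k < CARD('a)"
    and dom: "amp idx b (3 * k) < 3 * amp idx b k"
  shows "\<exists>r0>0. \<forall>r. 0 < r \<and> r < r0 \<longrightarrow>
    (\<exists>!\<theta>. 0 \<le> \<theta> \<and> \<theta> < 2 * pi \<and> stable_zero (g_theta idx k h b r) \<theta>) \<and>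
    (\<forall>\<theta>. stable_zero (g_theta idx k h b r) \<theta> \<longrightarrow>
      max_actions (crit_dir idx k \<theta>) \<subseteq> max_actions (orth_proj (crit_space idx k) b))"
proof -
  let ?R = "amp idx b k" and ?p = "phase idx b k" and ?q = "phase idx b (3 * k)"
  let ?\<beta> = "amp idx b (3 * k) / ?R"
  have "0 \<le> amp idx b (3 * k)"
    by (simp add: amp_def)
  \<comment> \<open>A nonnegative third-harmonic amplitude makes the strict inequality
    \<open>dom\<close> yield a positive critical one, so the ratio is meaningful.\<close>
  then have R: "0 < ?R" and \<beta>: "\<bar>?\<beta>\<bar> \<le> 3"
    using dom by (auto simp: divide_le_eq)
  obtain \<delta> where \<delta>: "0 < \<delta>" "\<And>w. (\<And>j. \<bar>w $ j - crit_dir idx k ?p $ j\<bar> < \<delta>) \<Longrightarrow>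
      max_actions w \<subseteq> max_actions (crit_dir idx k ?p)"
    using max_actions_stable by blast
  \<comment> \<open>The value 1/100 is the threshold for \<open>e\<close>. Entries of the direction
    move by at most \<open>16 * \<bar>e\<bar>\<close>: 4 from the zero estimate, 2 from the cosine
    shift, 2 bounding \<open>sqrt 2\<close>. Taking 17 makes the final bound strict.\<close>
  define c where "c = min (1/100) (\<delta> / 17)"
  \<comment> \<open>The cap 1 gives \<open>r\<^sup>2 \<le> r\<close>, and adding 1 to
    \<open>\<bar>h\<bar>\<close> keeps the divisor positive.\<close>
  define r0 where "r0 = min 1 (c / (\<bar>h\<bar> + 1))"
  have "0 < c"
    using \<delta> by (simp add: c_def)
  then have "0 < r0"
    by (simp add: r0_def)
  show ?thesis
  proof (rule exI[of _ r0], rule conjI[OF \<open>0 < r0\<close>], rule allI, rule impI)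
    fix r
    assume "0 < r \<and> r < r0"
    then have r: "0 < r" "r < r0" by auto
    let ?F = "perturbed_sine (h * r\<^sup>2) ?\<beta> ?p ?q"
    have "r\<^sup>2 \<le> r"
      using r by (simp add: r0_def power2_eq_square mult_left_le)
    then have "\<bar>h * r\<^sup>2\<bar> \<le> (\<bar>h\<bar> + 1) * r"
      by (auto simp: abs_mult intro!: mult_mono)
    also have "\<dots> \<le> c"
      using r by (simp add: r0_def field_simps)
    finally have e: "\<bar>h * r\<^sup>2\<bar> \<le> 1/100" and e\<delta>: "17 * \<bar>h * r\<^sup>2\<bar> \<le> \<delta>"
      by (auto simp: c_def)
    have st: "stable_zero (g_theta idx k h b r) = stable_zero ?F"
      using R stable_zero_cmult[of "?R / sqrt 2" ?F]
      by (intro ext) (simp add: g_theta_perturbed_sine)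
    have "\<exists>!\<theta>. 0 \<le> \<theta> \<and> \<theta> < 2 * pi \<and> stable_zero ?F \<theta>"
      using perturbed_sine_stable_zero_exists[OF e \<beta>, of ?p ?q]
        perturbed_sine_stable_zero_unique[OF e \<beta>, of ?p ?q]
      by (auto simp: abs_if)
    moreover have "max_actions (crit_dir idx k \<theta>) \<subseteq> max_actions (orth_proj (crit_space idx k) b)"
      if "stable_zero ?F \<theta>" for \<theta>
    proof -
      have z: "?F \<theta> = 0" "0 < cos (?p - \<theta>)"
        using that stable_zero_perturbed_sine[OF e \<beta>] by auto
      have "\<bar>crit_dir idx k \<theta> $ j - crit_dir idx k ?p $ j\<bar> < \<delta>" for j
      proof -
        let ?x = "real k * ring_pt idx j"
        have "\<bar>cos (?x - \<theta>) - cos (?x - ?p)\<bar> \<le> 8 * \<bar>h * r\<^sup>2\<bar>"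
          using abs_cos_shift_diff_le[of ?p \<theta> ?x] perturbed_sine_zero_sin[OF e \<beta> z(1)] z(2)
          by linarith
        moreover have "sqrt 2 \<le> 2"
          by (rule real_le_lsqrt) auto
        ultimately have "sqrt 2 * \<bar>cos (?x - \<theta>) - cos (?x - ?p)\<bar> \<le> 2 * (8 * \<bar>h * r\<^sup>2\<bar>)"
          by (intro mult_mono) auto
        moreover have "\<bar>crit_dir idx k \<theta> $ j - crit_dir idx k ?p $ j\<bar> =
            sqrt 2 * \<bar>cos (?x - \<theta>) - cos (?x - ?p)\<bar>"
          unfolding crit_dir_nth right_diff_distrib[symmetric] abs_mult by simp
        ultimately show ?thesis
          using e\<delta> \<delta>(1) by linarith
      qed
      then have "max_actions (crit_dir idx k \<theta>) \<subseteq> max_actions (crit_dir idx k ?p)"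
        by (rule \<delta>(2))
      also have "\<dots> = max_actions (orth_proj (crit_space idx k) b)"
        unfolding orth_proj_crit_dir[OF idx k] using R by (simp add: max_actions_scaleR)
      finally show ?thesis .
    qed
    ultimately show "(\<exists>!\<theta>. 0 \<le> \<theta> \<and> \<theta> < 2 * pi \<and> stable_zero (g_theta idx k h b r) \<theta>) \<and>
      (\<forall>\<theta>. stable_zero (g_theta idx k h b r) \<theta> \<longrightarrow>
        max_actions (crit_dir idx k \<theta>) \<subseteq> max_actions (orth_proj (crit_space idx k) b))"
      unfolding st by blast
  qed
qed

text \<open>Unique existence within one period justifies speaking of the stable equilibrium.
  Selection is asserted for every real representative, and as an inclusion, because several actions
  may maximise the critical direction.\<close>

theorem mainTheorem4:
  fixes idx :: "'a::finite \<Rightarrow> nat"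
    and A :: "real^'a^'a"
    and lam :: "nat \<Rightarrow> real"
    and ks :: nat
    and tau d :: real
    and S :: "real \<Rightarrow> real"
  assumes idx: "bij_betw idx UNIV {..<CARD('a)}"
    and A_sym: "transpose A = A"
    and A_circ: "circulant idx A"
    and eigen: "\<And>k. k \<le> CARD('a) div 2 \<Longrightarrow>
          A *v cos_mode idx k = lam k *\<^sub>R cos_mode idx k \<and>
          A *v sin_mode idx k = lam k *\<^sub>R sin_mode idx k"
    and ks_range: "0 < ks" "2 * ks < CARD('a)"
    and ks_dominant: "\<And>k. k \<le> CARD('a) div 2 \<Longrightarrow> k \<noteq> ks \<Longrightarrow> lam k < lam ks"
    and lam_pos: "0 < lam ks"
    and tau_pos: "0 < tau"
    and d_pos: "0 < d"
    and S_odd: "\<And>x. S (- x) = - S x"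
    and S_C3: "C3_fun S"
    and S_sigmoidal: "sigmoidal S"
    and S_deriv1: "deriv S 0 = 1"
    and S_deriv3: "(deriv ^^ 3) S 0 \<noteq> 0"
  shows "\<exists>\<epsilon>>0. \<forall>alpha>0. \<forall>b :: real^'a.
           \<bar>mu d lam ks alpha\<bar> < \<epsilon> \<longrightarrow>
           norm b < \<epsilon> \<longrightarrow>
           3 * amp idx b ks > amp idx b (3 * ks) \<longrightarrow>
           (\<forall>m \<le> CARD('a) div 2. m \<noteq> ks \<longrightarrow> amp idx b m / \<bar>sigma_mode d lam ks m\<bar> < \<epsilon>) \<longrightarrow>
           (\<exists>r0>0. \<forall>r. 0 < r \<and> r < r0 \<longrightarrow>
              (\<exists>!\<theta>. 0 \<le> \<theta> \<and> \<theta> < 2 * pi \<and>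
                    stable_zero (g_theta idx ks (eta S d lam ks) b r) \<theta>) \<and>
              (\<forall>\<theta>. stable_zero (g_theta idx ks (eta S d lam ks) b r) \<theta> \<longrightarrow>
                   max_actions (crit_dir idx ks \<theta>)
                     \<subseteq> max_actions (orth_proj (crit_space idx ks) b)))"
  \<comment> \<open>The angular lemma is applied with \<open>h\<close> as
    \<open>eta S d lam ks\<close> and supplies \<open>r0\<close> once \<open>b\<close> is
    fixed.\<close>
  by (rule exI[of _ "1::real"], intro conjI zero_less_one allI impI)
    (rule angular_equilibrium_selects_best_response[OF idx ks_range])

end
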